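(* Let $\phi$ be a holomorphic function of $(z_1,z_2)$ on an open subset $U\subset\mathbb{C}^2$ satisfying $$\Big|\frac{\partial^2\phi}{\partial z_1^2}\Big|^2-\Big|\frac{\partial^2\phi}{\partial z_2^2}\Big|^2=0,$$ let $L_\phi=\big\{\big(z_1,z_2,\frac{\partial\phi}{\partial z_1},\frac{\partial\phi}{\partial z_2}\big):(z_1,z_2)\in U\big\}\subset\mathbb{C}^4$, and let $G:T^*\mathbb{R}^4\to\mathbb{C}^4$ be the map $$G(q,p)=(p_1-ip_2,\;q_3+iq_4,\;-q_1-iq_2,\;p_3-ip_4).$$ Then $G^{-1}(L_\phi)$ is a generalized solution of the real Monge-Ampère equation $\operatorname{hess} f=1$ in four variables.
   Context: $T^*\mathbb{R}^4\cong\mathbb{R}^8$ has coordinates $(q,p)=(q_1,\dots,q_4,p_1,\dots,p_4)$ and symplectic form $\Omega=\sum_{j=1}^4 dq_j\wedge dp_j$. For a smooth function $f$ on $\mathbb{R}^4$, $\operatorname{hess} f$ is the determinant of the Hessian matrix of $f$. The equation $\operatorname{hess} f=1$ corresponds to the $4$-form $$\omega_{H+}=dp_1\wedge dp_2\wedge dp_3\wedge dp_4-dq_1\wedge dq_2\wedge dq_3\wedge dq_4,$$ in the sense that $f$ is a solution iff $(df)^*\omega_{H+}=0$. A generalized solution of $\operatorname{hess} f=1$ is a lagrangian submanifold $L$ of $(T^*\mathbb{R}^4,\Omega)$ (i.e. $\dim_{\mathbb{R}}L=4$ and $\Omega|_L=0$) such that $\omega_{H+}|_L=0$. *)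

theory Defs
  imports "HOL-Analysis.Analysis"
begin

section \<open>Smooth maps, embedded submanifolds and tangent spaces\<close>

text \<open>Continuous differentiability of order \<open>n\<close>, by iterated directional derivatives.
  It is only used for open domains.\<close>

primrec Ck_on :: "nat \<Rightarrow> 'a::real_normed_vector set \<Rightarrow> ('a \<Rightarrow> 'b::real_normed_vector) \<Rightarrow> bool" where
  "Ck_on 0 S f \<longleftrightarrow> continuous_on S f"
| "Ck_on (Suc n) S f \<longleftrightarrow> (\<forall>x\<in>S. f differentiable (at x)) \<and>
     (\<forall>v. Ck_on n S (\<lambda>x. frechet_derivative f (at x) v))"

definition smooth_on :: "'a::real_normed_vector set \<Rightarrow> ('a \<Rightarrow> 'b::real_normed_vector) \<Rightarrow> bool" where
  "smooth_on S f \<longleftrightarrow> (\<forall>n. Ck_on n S f)"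

definition diffeomorphism ::
  "'a::real_normed_vector set \<Rightarrow> 'b::real_normed_vector set \<Rightarrow> ('a \<Rightarrow> 'b) \<Rightarrow> ('b \<Rightarrow> 'a) \<Rightarrow> bool" where
  "diffeomorphism V W h g \<longleftrightarrow> homeomorphism V W h g \<and> smooth_on V h \<and> smooth_on W g"

text \<open>Embedded submanifolds (not necessarily closed), by slice charts of the ambient space.\<close>

definition submanifold :: "nat \<Rightarrow> 'a::euclidean_space set \<Rightarrow> bool" where
  "submanifold k L \<longleftrightarrow> (\<forall>x\<in>L. \<exists>V (W::'a set) h g T. open V \<and> x \<in> V \<and> open W \<and> diffeomorphism V W h g \<and>
     subspace T \<and> dim T = k \<and> h ` (L \<inter> V) = T \<inter> W)"

definition tangent_space :: "'a::euclidean_space set \<Rightarrow> 'a \<Rightarrow> 'a set" where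
  "tangent_space L x = {v. \<exists>(\<gamma>::real \<Rightarrow> 'a) e. 0 < e \<and> smooth_on {-e<..<e} \<gamma> \<and> \<gamma> ` {-e<..<e} \<subseteq> L \<and>
     \<gamma> 0 = x \<and> (\<gamma> has_vector_derivative v) (at 0)}"

section \<open>Differential forms with constant coefficients\<close>

text \<open>A form with constant coefficients is given by its value, independent of the base point,
  on a family of vectors indexed by a finite type \<open>'k\<close>; its degree is the cardinality of \<open>'k\<close>.
  Since \<open>det\<close> is unchanged under a simultaneous permutation of rows and columns, \<open>wedge\<close> does not
  depend on an ordering of \<open>'k\<close>.\<close>

type_synonym ('a, 'k) const_form = "('k \<Rightarrow> 'a) \<Rightarrow> real"

definition wedge :: "('k::finite \<Rightarrow> 'a \<Rightarrow> real) \<Rightarrow> ('a, 'k) const_form" where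
  "wedge \<alpha> v = det (\<chi> i j. \<alpha> i (v j))"

definition vanishes_on :: "('a::euclidean_space, 'k) const_form \<Rightarrow> 'a set \<Rightarrow> bool" where
  "vanishes_on \<omega> L \<longleftrightarrow> (\<forall>x\<in>L. \<forall>v. (\<forall>i. v i \<in> tangent_space L x) \<longrightarrow> \<omega> v = 0)"

section \<open>Generalized solutions on the cotangent bundle of $\mathbf{R}^4$\<close>

text \<open>Points of the cotangent bundle, and tangent vectors, are pairs \<open>(q, p)\<close>.\<close>

type_synonym cotangent4 = "(real^4) \<times> (real^4)"

definition dq :: "4 \<Rightarrow> cotangent4 \<Rightarrow> real" where
  "dq j v = fst v $ j"

definition dp :: "4 \<Rightarrow> cotangent4 \<Rightarrow> real" where
  "dp j v = snd v $ j"

definition symplectic_form :: "(cotangent4, 2) const_form" where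
  "symplectic_form v = (\<Sum>j\<in>UNIV. wedge (\<lambda>i::2. if i = 1 then dq j else dp j) v)"

definition lagrangian_submanifold :: "cotangent4 set \<Rightarrow> bool" where
  "lagrangian_submanifold L \<longleftrightarrow> submanifold 4 L \<and> vanishes_on symplectic_form L"

text \<open>The pullback of \<open>omega_Hplus\<close> along the section \<open>df\<close>, i.e. \<open>p\<^sub>j = \<partial>f/\<partial>q\<^sub>j\<close>, is \<open>hess f - 1\<close>
  times the volume form; hence it represents the equation \<open>hess f = 1\<close>.\<close>

definition omega_Hplus :: "(cotangent4, 4) const_form" where
  "omega_Hplus v = wedge dp v - wedge dq v"

definition generalized_solution_hess_eq_1 :: "cotangent4 set \<Rightarrow> bool" where
  "generalized_solution_hess_eq_1 L \<longleftrightarrow> lagrangian_submanifold L \<and> vanishes_on omega_Hplus L"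

section \<open>Holomorphic functions of several variables\<close>

text \<open>Complex differentiability: the real Frechet derivative exists and is complex linear.\<close>

definition holomorphic_several :: "(complex^'n \<Rightarrow> complex) \<Rightarrow> (complex^'n) set \<Rightarrow> bool" where
  "holomorphic_several f U \<longleftrightarrow>
     (\<forall>z\<in>U. \<exists>D. (f has_derivative D) (at z) \<and> (\<forall>c v. D (c *s v) = c * D v))"

definition cpartial :: "'n::finite \<Rightarrow> (complex^'n \<Rightarrow> complex) \<Rightarrow> complex^'n \<Rightarrow> complex" where
  "cpartial j f z = deriv (\<lambda>w. f (\<chi> i. if i = j then w else z $ i)) (z $ j)"

definition L_graph :: "(complex^2 \<Rightarrow> complex) \<Rightarrow> (complex^2) set \<Rightarrow> (complex^4) set" where
  "L_graph \<phi> U = {vector [z $ 1, z $ 2, cpartial 1 \<phi> z, cpartial 2 \<phi> z] | z. z \<in> U}"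

definition G :: "cotangent4 \<Rightarrow> complex^4" where
  "G = (\<lambda>(q, p). vector
     [of_real (p $ 1) - \<i> * of_real (p $ 2),
      of_real (q $ 3) + \<i> * of_real (q $ 4),
      - of_real (q $ 1) - \<i> * of_real (q $ 2),
      of_real (p $ 3) - \<i> * of_real (p $ 4)])"

lemma vector_4 [simp]:
  "(vector [w, x, y, z] :: 'a::zero^4) $ 1 = w"
  "(vector [w, x, y, z] :: 'a::zero^4) $ 2 = x"
  "(vector [w, x, y, z] :: 'a::zero^4) $ 3 = y"
  "(vector [w, x, y, z] :: 'a::zero^4) $ 4 = z"
  unfolding vector_def by simp_all

end

theory Submission
  imports Defs "HOL-Complex_Analysis.Cauchy_Integral_Formula"
begin

text \<open>Under \<open>G\<close>, with \<open>w\<^sub>j\<close> the coordinates dual to \<open>z\<^sub>j\<close>, the symplectic form is the real part of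
  \<open>dz\<^sub>1 \<and> dw\<^sub>1 + dz\<^sub>2 \<and> dw\<^sub>2\<close>, which vanishes on the graph of the gradient of \<open>\<phi>\<close> because the complex
  Hessian is symmetric. On that graph \<open>dp\<^sub>1 \<and> dp\<^sub>2 \<and> dp\<^sub>3 \<and> dp\<^sub>4\<close> and \<open>dq\<^sub>1 \<and> dq\<^sub>2 \<and> dq\<^sub>3 \<and> dq\<^sub>4\<close> are the
  multiples of the volume form in \<open>z\<close> by \<open>\<bar>\<phi>\<^sub>2\<^sub>2\<bar>\<^sup>2\<close> and \<open>\<bar>\<phi>\<^sub>1\<^sub>1\<bar>\<^sup>2\<close>, as the factors coming from \<open>z\<^sub>1\<close> and
  \<open>z\<^sub>2\<close> themselves cancel all mixed derivatives. Smoothness of \<open>\<phi>\<close> and symmetry of its second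
  derivative come from Cauchy's formula for the derivative along a complex line.\<close>

section \<open>Holomorphic functions of several variables\<close>

lemma continuous_on_vector_scalar_mult [continuous_intros]:
  fixes v :: "'b::topological_space \<Rightarrow> complex^'n"
  assumes "continuous_on S g" "continuous_on S v"
  shows "continuous_on S (\<lambda>x. g x *s v x)"
  unfolding vector_scalar_mult_def by (intro continuous_intros assms)

lemma bounded_linear_vector_scalar_mult_left:
  "bounded_linear (\<lambda>w::complex. w *s (v::complex^'n))"
  unfolding linear_conv_bounded_linear[symmetric]
  by (rule linearI) (auto simp: vec_eq_iff algebra_simps)

lemma holomorphic_several_has_derivative:
  assumes "holomorphic_several f U" "z \<in> U"
  shows "(f has_derivative frechet_derivative f (at z)) (at z)"
  using assms unfolding holomorphic_several_def
  by (meson differentiableI frechet_derivative_works)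

lemma holomorphic_several_scale:
  assumes "holomorphic_several f U" "z \<in> U"
  shows "frechet_derivative f (at z) (c *s v) = c * frechet_derivative f (at z) v"
  using assms unfolding holomorphic_several_def by (metis frechet_derivative_at)

lemma holomorphic_several_continuous_on:
  assumes "holomorphic_several f U"
  shows "continuous_on U f"
  using holomorphic_several_has_derivative[OF assms] continuous_at_imp_continuous_on
    has_derivative_continuous by blast

text \<open>Complex linearity turns the real derivative \<open>h \<mapsto> D (h *s v)\<close> from
  the chain rule into multiplication by the number \<open>D v\<close>. This opens the way to
  one-variable theory along every complex line.\<close>

lemma holomorphic_several_on_line:
  assumes "holomorphic_several f U" "z + w *s v \<in> U"
  shows "((\<lambda>w. f (z + w *s v)) has_field_derivative frechet_derivative f (at (z + w *s v)) v) (at w)"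
proof -
  have "((\<lambda>w. z + w *s v) has_derivative (\<lambda>h. h *s v)) (at w)"
    by (auto intro!: derivative_eq_intros bounded_linear_imp_has_derivative
        bounded_linear_vector_scalar_mult_left)
  from has_derivative_compose[OF this holomorphic_several_has_derivative[OF assms]]
  show ?thesis
    unfolding has_field_derivative_def
    by (rule has_derivative_eq_rhs) (simp add: fun_eq_iff holomorphic_several_scale[OF assms])
qed

text \<open>This is Cauchy's formula for the derivative at 0 of
  \<open>\<lambda>w. f (z + w *s v)\<close>, with the circle parametrised over [0,1]. The point
  \<open>z\<close> enters the integrand only through the argument of \<open>f\<close>, so regularity
  of \<open>f\<close> passes to its derivative.\<close>

lemma Cauchy_directional:
  assumes f: "holomorphic_several f U" and "0 < r"
    and U: "\<And>w. w \<in> cball 0 r \<Longrightarrow> z + w *s v \<in> U"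
  shows "frechet_derivative f (at z) v =
    integral (cbox 0 1) (\<lambda>t. f (z + (of_real r * cis (2*pi*t)) *s v) * (cis (- (2*pi*t)) / of_real r))"
proof -
  let ?g = "\<lambda>w. f (z + w *s v)"
  have der: "(?g has_field_derivative frechet_derivative f (at (z + w *s v)) v) (at w)"
    if "w \<in> cball 0 r" for w
    using holomorphic_several_on_line[OF f U[OF that]] .
  have cont: "continuous_on (cball 0 r) ?g"
    using der DERIV_isCont continuous_at_imp_continuous_on by blast
  have holo: "?g holomorphic_on ball 0 r"
    using der by (force simp: holomorphic_on_open)
  have "frechet_derivative f (at z) v =
      1 / (2 * of_real pi * \<i>) * contour_integral (circlepath 0 r) (\<lambda>u. ?g u / (u - 0)^2)"
    using DERIV_unique[OF der[of 0] Cauchy_derivative_integral_circlepath(2)[OF cont holo, of 0]]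
      \<open>0 < r\<close> by simp
  also have "\<dots> = integral {0..1} (\<lambda>t. 1 / (2 * of_real pi * \<i>) *
      (?g (circlepath 0 r t) / (circlepath 0 r t - 0)^2 * vector_derivative (circlepath 0 r) (at t)))"
    by (simp only: contour_integral_integral integral_mult_right)
  also have "\<dots> = integral {0..1} (\<lambda>t. ?g (of_real r * cis (2*pi*t)) * (cis (- (2*pi*t)) / of_real r))"
  proof (rule integral_cong)
    fix t :: real
    have c: "circlepath 0 r t = of_real r * cis (2*pi*t)"
      by (simp add: circlepath cis_conv_exp ac_simps)
    \<comment> \<open>This factor cancels \<open>2 * of_real pi * \<i>\<close> and one of the two
      powers in the denominator, leaving \<open>1 / circlepath 0 r t\<close>.\<close>
    have "vector_derivative (circlepath 0 r) (at t) = 2 * of_real pi * \<i> * circlepath 0 r t"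
      unfolding vector_derivative_circlepath by (simp add: circlepath)
    moreover have "circlepath 0 r t \<noteq> 0"
      using \<open>0 < r\<close> by (simp add: c)
    moreover have "cis (- (2*pi*t)) / of_real r = 1 / circlepath 0 r t"
      by (simp add: c cis_mult divide_simps)
    ultimately show "1 / (2 * of_real pi * \<i>) *
        (?g (circlepath 0 r t) / (circlepath 0 r t - 0)^2 * vector_derivative (circlepath 0 r) (at t)) =
        ?g (of_real r * cis (2*pi*t)) * (cis (- (2*pi*t)) / of_real r)"
      unfolding c[symmetric] by (simp add: power2_eq_square)
  qed
  finally show ?thesis by simp
qed

text \<open>One radius has to serve for all centres near \<open>z0\<close>, so that the circle of
  integration stays fixed while \<open>z\<close> varies. The second disc is for the double integral
  below; \<open>v' = 0\<close> reduces to a single disc.\<close>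

lemma open_bidisc_translates:
  fixes U :: "(complex^'n) set"
  assumes "open U" "z0 \<in> U"
  obtains r d where "0 < r" "0 < d"
    "\<And>z w w'. z \<in> ball z0 d \<Longrightarrow> w \<in> cball 0 r \<Longrightarrow> w' \<in> cball 0 r \<Longrightarrow> z + w *s v + w' *s v' \<in> U"
proof -
  let ?F = "\<lambda>(z, w, w'). z + w *s v + w' *s v'"
  have "open (?F -` U)"
    unfolding split_beta by (intro open_vimage assms continuous_intros)
  moreover have "(z0, 0, 0) \<in> ?F -` U"
    using assms by simp
  ultimately obtain e where e: "e > 0" "ball (z0, 0, 0) e \<subseteq> ?F -` U"
    by (meson openE)
  \<comment> \<open>The distance to the centre is below e/3 + e/4 + e/4 < e.\<close>
  have "z + w *s v + w' *s v' \<in> U"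
    if "z \<in> ball z0 (e/3)" "w \<in> cball 0 (e/4)" "w' \<in> cball 0 (e/4)" for z w w'
  proof -
    have "dist (z0, 0, 0) (z, w, w') \<le> dist z0 z + (dist 0 w + dist 0 w')"
      unfolding dist_Pair_Pair
      by (meson add_left_mono order_trans sqrt_sum_squares_le_sum zero_le_dist real_sqrt_ge_zero
          add_nonneg_nonneg zero_le_power2)
    also have "\<dots> < e"
      using that \<open>e > 0\<close> by simp
    finally show ?thesis
      using e by auto
  qed
  with \<open>e > 0\<close> show ?thesis
    by (intro that[of "e/4" "e/3"]) auto
qed

text \<open>Near \<open>z0\<close> the derivative is an integral, over a compact interval, of a
  kernel jointly continuous in \<open>z\<close> and \<open>t\<close>.\<close>

lemma continuous_on_directional_derivative:
  fixes f :: "complex^'n \<Rightarrow> complex"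
  assumes "open U" and f: "holomorphic_several f U"
  shows "continuous_on U (\<lambda>z. frechet_derivative f (at z) v)"
proof (rule continuous_at_imp_continuous_on, rule ballI)
  fix z0 assume "z0 \<in> U"
  obtain r d where r: "0 < r" and "0 < d" and
    "\<And>z w w'. z \<in> ball z0 d \<Longrightarrow> w \<in> cball 0 r \<Longrightarrow> w' \<in> cball 0 r \<Longrightarrow> z + w *s v + w' *s 0 \<in> U"
    using open_bidisc_translates[OF \<open>open U\<close> \<open>z0 \<in> U\<close>, of v 0] by metis
  then have U: "z + w *s v \<in> U" if "z \<in> ball z0 d" "w \<in> cball 0 r" for z w
    using that by fastforce
  let ?K = "\<lambda>z t. f (z + (of_real r * cis (2*pi*t)) *s v) * (cis (- (2*pi*t)) / of_real r)"
  have "continuous_on (ball z0 d \<times> cbox 0 1) (\<lambda>(z, t). ?K z t)"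
    unfolding split_beta using r U
    by (intro continuous_intros continuous_on_compose2[OF holomorphic_several_continuous_on[OF f]])
      (auto simp: norm_mult)
  then have "continuous_on (ball z0 d) (\<lambda>z. integral (cbox 0 1) (?K z))"
    by (rule integral_continuous_on_param)
  then have "continuous_on (ball z0 d) (\<lambda>z. frechet_derivative f (at z) v)"
    by (rule continuous_on_eq) (simp only: Cauchy_directional[OF f r U])
  then show "isCont (\<lambda>z. frechet_derivative f (at z) v) z0"
    using \<open>0 < d\<close> by (simp add: continuous_on_eq_continuous_at)
qed

text \<open>Cauchy's formula is differentiated under the integral sign. The resulting derivative is
  an integral of complex linear maps, hence complex linear.\<close>

proposition holomorphic_several_directional_derivative:
  fixes f :: "complex^'n \<Rightarrow> complex"
  assumes "open U" and f: "holomorphic_several f U"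
  shows "holomorphic_several (\<lambda>z. frechet_derivative f (at z) v) U"
  unfolding holomorphic_several_def
proof
  fix z0 assume "z0 \<in> U"
  obtain r d where r: "0 < r" and "0 < d" and
    "\<And>z w w'. z \<in> ball z0 d \<Longrightarrow> w \<in> cball 0 r \<Longrightarrow> w' \<in> cball 0 r \<Longrightarrow> z + w *s v + w' *s 0 \<in> U"
    using open_bidisc_translates[OF \<open>open U\<close> \<open>z0 \<in> U\<close>, of v 0] by metis
  then have U: "z + w *s v \<in> U" if "z \<in> ball z0 d" "w \<in> cball 0 r" for z w
    using that by fastforce
  define \<zeta> where "\<zeta> = (\<lambda>z t. z + (of_real r * cis (2*pi*t)) *s v)"
  define k where "k = (\<lambda>t. cis (- (2*pi*t)) / of_real r)"
  have \<zeta>: "\<zeta> z t \<in> U" if "z \<in> ball z0 d" for z t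
    unfolding \<zeta>_def using that r by (intro U) (auto simp: norm_mult)
  have cont_\<zeta>: "continuous_on S (\<lambda>x. \<zeta> (fst x) (snd x))" for S
    unfolding \<zeta>_def by (intro continuous_intros)
  have cont_k: "continuous_on S (\<lambda>x. k (snd x))" for S :: "((complex^'n) \<times> real) set"
    unfolding k_def using r by (intro continuous_intros) auto
  \<comment> \<open>The Leibniz rule wants the derivative of the integrand as a continuous family of
    bounded linear operators.\<close>
  define F where "F = (\<lambda>z. Blinfun (frechet_derivative f (at z)))"
  have F: "blinfun_apply (F z) = frechet_derivative f (at z)" if "z \<in> U" for z
    unfolding F_def
    using holomorphic_several_has_derivative[OF f that] by (simp add: bounded_linear_Blinfun_apply has_derivative_bounded_linear)
  \<comment> \<open>In finite dimension it is enough to evaluate on basis vectors, which gives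
    directional derivatives.\<close>
  have "continuous_on U F"
    by (rule continuous_on_blinfun_componentwise,
        rule continuous_on_eq[OF continuous_on_directional_derivative[OF \<open>open U\<close> f]])
      (simp add: F)
  then have cont_F: "continuous_on (ball z0 d \<times> cbox 0 1) (\<lambda>x. F (\<zeta> (fst x) (snd x)))"
    by (rule continuous_on_compose2[OF _ cont_\<zeta>]) (auto simp del: mem_ball simp: \<zeta>)
  let ?D = "\<lambda>z t. blinfun_mult_left (k t) o\<^sub>L F (\<zeta> z t)"
  have cont_D: "continuous_on (ball z0 d \<times> cbox 0 1) (\<lambda>x. ?D (fst x) (snd x))"
    by (intro bounded_bilinear.continuous_on[OF bounded_bilinear_blinfun_compose] cont_F
        bounded_linear.continuous_on[OF bounded_linear_blinfun_mult_left] cont_k)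
  have "((\<lambda>z. integral (cbox 0 1) (\<lambda>t. f (\<zeta> z t) * k t)) has_derivative
      blinfun_apply (integral (cbox 0 1) (?D z0))) (at z0 within ball z0 d)"
  proof (rule leibniz_rule)
    fix z :: "complex^'n" and t :: real
    assume z: "z \<in> ball z0 d"
    have "((\<lambda>z. \<zeta> z t) has_derivative (\<lambda>h. h)) (at z within ball z0 d)"
      unfolding \<zeta>_def by (auto intro!: derivative_eq_intros)
    from has_derivative_mult_left[OF has_derivative_compose[OF this
        holomorphic_several_has_derivative[OF f \<zeta>[OF z]]], of "k t"]
    show "((\<lambda>z. f (\<zeta> z t) * k t) has_derivative blinfun_apply (?D z t)) (at z within ball z0 d)"
      by (rule has_derivative_eq_rhs) (auto simp: F \<zeta>[OF z])
  next
    fix z assume z: "z \<in> ball z0 d"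
    have "continuous_on (cbox 0 1) (\<lambda>t. f (\<zeta> z t) * k t)"
      using r \<zeta>[OF z] unfolding k_def
      by (intro continuous_intros continuous_on_compose2[OF holomorphic_several_continuous_on[OF f]])
        (auto simp: \<zeta>_def intro!: continuous_intros)
    then show "(\<lambda>t. f (\<zeta> z t) * k t) integrable_on cbox 0 1"
      by (rule integrable_continuous)
  next
    show "continuous_on (ball z0 d \<times> cbox 0 1) (\<lambda>(z, t). ?D z t)"
      unfolding split_beta by (rule cont_D)
  qed (use \<open>0 < d\<close> in auto)
  then have "((\<lambda>z. integral (cbox 0 1) (\<lambda>t. f (\<zeta> z t) * k t)) has_derivative
      blinfun_apply (integral (cbox 0 1) (?D z0))) (at z0)"
    using \<open>0 < d\<close> by (simp add: at_within_open[of _ "ball z0 d"])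
  then have "((\<lambda>z. frechet_derivative f (at z) v) has_derivative
      blinfun_apply (integral (cbox 0 1) (?D z0))) (at z0)"
    by (rule has_derivative_transform_within_open[of _ _ _ _ "ball z0 d"])
      (use \<open>0 < d\<close> in \<open>simp_all only: Cauchy_directional[OF f r U] \<zeta>_def k_def open_ball centre_in_ball\<close>)
  \<comment> \<open>Evaluation at \<open>h\<close> commutes with the operator-valued integral, and
    the constant \<open>c\<close> comes out of each integrand.\<close>
  moreover have "blinfun_apply (integral (cbox 0 1) (?D z0)) (c *s h) =
      c * blinfun_apply (integral (cbox 0 1) (?D z0)) h" for c h
  proof -
    have "z0 \<in> ball z0 d"
      using \<open>0 < d\<close> by simp
    have "continuous_on (cbox 0 1) (\<lambda>t. ?D z0 t)"
      using continuous_on_compose2[OF cont_D continuous_on_Pair[OF continuous_on_const continuous_on_id],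
          where s = "cbox 0 1", of z0] \<open>z0 \<in> ball z0 d\<close>
      by (simp only: fst_conv snd_conv image_subset_iff mem_Times_iff simp_thms) blast
    then have "?D z0 integrable_on cbox 0 1"
      by (rule integrable_continuous)
    then show ?thesis
      by (simp add: blinfun_apply_integral F \<zeta>[OF \<open>z0 \<in> ball z0 d\<close>] holomorphic_several_scale[OF f]
          mult.assoc)
  qed
  ultimately show "\<exists>D. ((\<lambda>z. frechet_derivative f (at z) v) has_derivative D) (at z0) \<and>
      (\<forall>c h. D (c *s h) = c * D h)"
    by blast
qed

text \<open>By Cauchy's formula along two complex lines, both sides are the same double integral, in the two
  orders of integration.\<close>

lemma symmetric_second_derivative:
  fixes f :: "complex^'n \<Rightarrow> complex"
  assumes "open U" and f: "holomorphic_several f U" and "z \<in> U"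
  shows "frechet_derivative (\<lambda>z. frechet_derivative f (at z) v) (at z) u =
    frechet_derivative (\<lambda>z. frechet_derivative f (at z) u) (at z) v"
proof -
  obtain r d where r: "0 < r" and "0 < d" and
    "\<And>z' w w'. z' \<in> ball z d \<Longrightarrow> w \<in> cball 0 r \<Longrightarrow> w' \<in> cball 0 r \<Longrightarrow> z' + w *s u + w' *s v \<in> U"
    using open_bidisc_translates[OF \<open>open U\<close> \<open>z \<in> U\<close>, of u v] by metis
  then have U: "z + w *s u + w' *s v \<in> U" if "w \<in> cball 0 r" "w' \<in> cball 0 r" for w w'
    using that by simp
  define e where "e = (\<lambda>t. of_real r * cis (2*pi*t))"
  define k where "k = (\<lambda>t. cis (- (2*pi*t)) / of_real r)"
  have e: "e t \<in> cball 0 r" for t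
    using r by (simp add: e_def norm_mult)
  \<comment> \<open>The outer circle runs along \<open>u\<close>, the inner one along
    \<open>v\<close>. Both are bound afresh here, so that the formula is available with the two
    directions exchanged.\<close>
  have double: "frechet_derivative (\<lambda>z. frechet_derivative f (at z) v) (at z) u =
      integral (cbox 0 1) (\<lambda>t. integral (cbox 0 1) (\<lambda>s. f (z + e t *s u + e s *s v) * k s * k t))"
    if U: "\<And>w w'. w \<in> cball 0 r \<Longrightarrow> w' \<in> cball 0 r \<Longrightarrow> z + w *s u + w' *s v \<in> U" for u v
  proof -
    have "z + w *s u \<in> U" if "w \<in> cball 0 r" for w
      using U[OF that, of 0] r by simp
    from Cauchy_directional[OF holomorphic_several_directional_derivative[OF \<open>open U\<close> f] r this]
    have "frechet_derivative (\<lambda>z. frechet_derivative f (at z) v) (at z) u =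
      integral (cbox 0 1) (\<lambda>t. frechet_derivative f (at (z + e t *s u)) v * k t)"
      by (simp add: e_def k_def)
    also have "\<dots> = integral (cbox 0 1) (\<lambda>t. integral (cbox 0 1) (\<lambda>s. f (z + e t *s u + e s *s v) * k s) * k t)"
      using Cauchy_directional[OF f r U[OF e]] by (simp add: e_def k_def)
    finally show ?thesis by simp
  qed
  have "integral (cbox 0 1) (\<lambda>t. integral (cbox 0 1) (\<lambda>s. f (z + e t *s u + e s *s v) * k s * k t)) =
      integral (cbox 0 1) (\<lambda>s. integral (cbox 0 1) (\<lambda>t. f (z + e t *s u + e s *s v) * k s * k t))"
    using r U[OF e e] unfolding k_def
    by (intro integral_swap_continuous, unfold split_beta)
      (intro continuous_intros continuous_on_compose2[OF holomorphic_several_continuous_on[OF f]],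
       auto simp: e_def intro!: continuous_intros)
  also have "\<dots> = integral (cbox 0 1) (\<lambda>s. integral (cbox 0 1) (\<lambda>t. f (z + e s *s v + e t *s u) * k t * k s))"
    by (simp add: ac_simps)
  finally show ?thesis
    using double[OF U] double[of v u] U by (simp add: add.assoc add.commute[of "_ *s v" "_ *s u"])
qed

section \<open>Smooth functions and graphs\<close>

lemma Ck_on_cong:
  assumes "open S" "\<And>x. x \<in> S \<Longrightarrow> f x = g x" "Ck_on n S f"
  shows "Ck_on n S g"
  using assms(2,3)
proof (induction n arbitrary: f g)
  case 0
  then show ?case
    by (simp cong: continuous_on_cong)
next
  case (Suc n)
  have eq: "frechet_derivative f (at x) = frechet_derivative g (at x)" if "x \<in> S" for x
    using frechet_derivative_transform_within_open[of f x S g] Suc.prems that \<open>open S\<close> by simp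
  have "g differentiable at x" if "x \<in> S" for x
    using Suc.prems that \<open>open S\<close> unfolding differentiable_def
    by (metis Ck_on.simps(2) differentiable_def has_derivative_transform_within_open)
  moreover have "Ck_on n S (\<lambda>x. frechet_derivative g (at x) v)" for v
    using Suc.IH[of "\<lambda>x. frechet_derivative f (at x) v"] Suc.prems eq by simp
  ultimately show ?case
    by simp
qed

text \<open>Lets an explicit derivative stand in for \<open>frechet_derivative\<close>, as the
  differentiation rules supply it.\<close>

lemma Ck_on_SucI:
  assumes "open S" "\<And>x. x \<in> S \<Longrightarrow> (f has_derivative f' x) (at x)"
    and "\<And>v. Ck_on n S (\<lambda>x. f' x v)"
  shows "Ck_on (Suc n) S f"
proof -
  have "Ck_on n S (\<lambda>x. frechet_derivative f (at x) v)" for v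
    by (rule Ck_on_cong[OF \<open>open S\<close> _ assms(3)]) (simp add: frechet_derivative_at[OF assms(2), symmetric])
  with assms(2) show ?thesis
    by (auto intro: differentiableI)
qed

lemma Ck_on_Suc_has_derivative:
  assumes "Ck_on (Suc n) S f" "x \<in> S"
  shows "(f has_derivative frechet_derivative f (at x)) (at x)"
  using assms frechet_derivative_works by auto

lemma Ck_on_const:
  assumes "open S"
  shows "Ck_on n S (\<lambda>x. c)"
proof (induction n arbitrary: c)
  case (Suc n)
  then show ?case
    by (intro Ck_on_SucI[OF assms, of _ "\<lambda>x v. 0"]) auto
qed simp

lemma Ck_on_bounded_linear:
  assumes "open S" "bounded_linear A"
  shows "Ck_on n S A"
proof (cases n)
  case 0
  then show ?thesis
    by (simp add: assms linear_continuous_on)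
next
  case (Suc m)
  then show ?thesis
    using Ck_on_SucI[OF \<open>open S\<close>, of A "\<lambda>x. A"] assms
    by (metis Ck_on_const bounded_linear_imp_has_derivative)
qed

lemma Ck_on_add:
  assumes "open S" "Ck_on n S f" "Ck_on n S g"
  shows "Ck_on n S (\<lambda>x. f x + g x)"
  using assms(2,3)
proof (induction n arbitrary: f g)
  case 0
  then show ?case
    by (simp add: continuous_on_add)
next
  case (Suc n)
  then show ?case
    by (intro Ck_on_SucI[OF \<open>open S\<close>
          has_derivative_add[OF Ck_on_Suc_has_derivative Ck_on_Suc_has_derivative]])
      (auto intro: Suc.IH)
qed

lemma Ck_on_bounded_linear_compose:
  assumes "open S" "bounded_linear A" "Ck_on n S f"
  shows "Ck_on n S (\<lambda>x. A (f x))"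
  using assms(3)
proof (induction n arbitrary: f)
  case 0
  then show ?case
    by (simp add: bounded_linear.continuous_on[OF \<open>bounded_linear A\<close>])
next
  case (Suc n)
  then show ?case
    by (intro Ck_on_SucI[OF \<open>open S\<close>
          bounded_linear.has_derivative[OF \<open>bounded_linear A\<close> Ck_on_Suc_has_derivative]])
      (auto intro: Suc.IH)
qed

text \<open>Differentiating along \<open>v\<close> gives the derivative of \<open>f\<close> along
  \<open>A v\<close>, again composed with \<open>A\<close>, so the induction closes on maps of this
  shape.\<close>

lemma Ck_on_compose_bounded_linear:
  assumes "open S" "bounded_linear A" "Ck_on n S f"
  shows "Ck_on n (A -` S) (\<lambda>x. f (A x))"
  using assms(3)
proof (induction n arbitrary: f)
  case 0
  then show ?case
    by (auto intro: continuous_on_compose2 linear_continuous_on assms)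
next
  case (Suc n)
  have "open (A -` S)"
    using assms by (intro open_vimage linear_continuous_on)
  then show ?case
  proof (rule Ck_on_SucI)
    show "((\<lambda>x. f (A x)) has_derivative (\<lambda>v. frechet_derivative f (at (A x)) (A v))) (at x)"
      if "x \<in> A -` S" for x
      using has_derivative_compose[OF bounded_linear_imp_has_derivative[OF \<open>bounded_linear A\<close>]
        Ck_on_Suc_has_derivative[OF Suc.prems]] that by simp
    show "Ck_on n (A -` S) (\<lambda>x. frechet_derivative f (at (A x)) (A v))" for v
      using Suc.prems by (intro Suc.IH[of "\<lambda>y. frechet_derivative f (at y) (A v)"]) simp
  qed
qed

text \<open>Directional derivatives are holomorphic again, so the induction on the order reproduces
  its own hypothesis.\<close>

lemma holomorphic_several_smooth_on:
  assumes "open U" "holomorphic_several f U"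
  shows "smooth_on U f"
proof -
  have "Ck_on n U f" for n
    using assms(2)
  proof (induction n arbitrary: f)
    case 0
    then show ?case
      by (simp add: holomorphic_several_continuous_on)
  next
    case (Suc n)
    show ?case
      by (rule Ck_on_SucI[OF \<open>open U\<close> holomorphic_several_has_derivative[OF Suc.prems]
            Suc.IH[OF holomorphic_several_directional_derivative[OF \<open>open U\<close> Suc.prems]]])
  qed
  then show ?thesis
    by (simp add: smooth_on_def)
qed

text \<open>The maps \<open>J\<close> and \<open>K\<close> are the two inclusions of the splitting with projections \<open>P\<close> and \<open>Q\<close>. The
  shear \<open>x \<mapsto> x - K (F (P x))\<close> straightens the graph, hence is a slice chart.\<close>

lemma submanifold_graph:
  fixes P :: "'a::euclidean_space \<Rightarrow> 'b::euclidean_space"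
    and Q :: "'a \<Rightarrow> 'c::euclidean_space"
  assumes lin: "linear P" "linear Q" "linear J" "linear K"
    and PJ: "\<And>y. P (J y) = y" and QJ: "\<And>y. Q (J y) = 0"
    and PK: "\<And>w. P (K w) = 0" and QK: "\<And>w. Q (K w) = w"
    and split: "\<And>x. J (P x) + K (Q x) = x"
    and "open U" and F: "smooth_on U F"
  shows "submanifold DIM('b) {x. P x \<in> U \<and> Q x = F (P x)}" (is "submanifold _ ?L")
  unfolding submanifold_def
proof
  fix x assume "x \<in> ?L"
  define V where "V = P -` U"
  define h where "h = (\<lambda>x. x + - K (F (P x)))"
  define g where "g = (\<lambda>x. x + K (F (P x)))"
  have "open V"
    unfolding V_def using lin \<open>open U\<close>
    by (intro open_vimage linear_continuous_on) (simp_all add: linear_conv_bounded_linear)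
  have FP: "Ck_on n V (\<lambda>x. F (P x))" for n
    unfolding V_def using F lin \<open>open U\<close>
    by (intro Ck_on_compose_bounded_linear) (simp_all add: smooth_on_def linear_conv_bounded_linear)
  have id: "Ck_on n V (\<lambda>x. x)" for n
    using Ck_on_bounded_linear[OF \<open>open V\<close> bounded_linear_ident] .
  have K: "bounded_linear K" "bounded_linear (\<lambda>w. - K w)"
    using lin by (simp_all add: linear_conv_bounded_linear bounded_linear_minus)
  have "Ck_on n V h" "Ck_on n V g" for n
    unfolding h_def g_def
    by (rule Ck_on_add[OF \<open>open V\<close> id]; rule Ck_on_bounded_linear_compose[OF \<open>open V\<close> K(2) FP]
        Ck_on_bounded_linear_compose[OF \<open>open V\<close> K(1) FP])+
  then have "smooth_on V h" "smooth_on V g"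
    by (simp_all add: smooth_on_def)
  \<comment> \<open>Since \<open>P\<close> kills the range of \<open>K\<close>, the shear keeps
    \<open>P x\<close> fixed. Hence \<open>h\<close> and \<open>g\<close> are mutually inverse, and
    \<open>V\<close> is both source and target of the chart.\<close>
  have Ph: "P (h x) = P x" and Pg: "P (g x) = P x" for x
    using lin by (simp_all add: h_def g_def linear_add linear_diff linear_neg PK)
  have gh: "g (h x) = x" and hg: "h (g x) = x" for x
    using Ph[of x] Pg[of x] by (simp_all add: h_def g_def)
  have hV: "h x \<in> V \<longleftrightarrow> x \<in> V" and gV: "g x \<in> V \<longleftrightarrow> x \<in> V" for x
    by (simp_all add: V_def Ph Pg)
  have "homeomorphism V V h g"
    unfolding homeomorphism_def
  proof (intro conjI ballI)
    show "continuous_on V h" "continuous_on V g"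
      using \<open>smooth_on V h\<close> \<open>smooth_on V g\<close> unfolding smooth_on_def by (metis Ck_on.simps(1))+
    show "h ` V = V" "g ` V = V"
      using hV gV by auto (metis gh hg image_eqI)+
  qed (auto simp: gh hg)
  then have "diffeomorphism V V h g"
    unfolding diffeomorphism_def using \<open>smooth_on V h\<close> \<open>smooth_on V g\<close> by simp
  \<comment> \<open>The slice is the kernel of \<open>Q\<close>, on which \<open>h\<close> lands
    exactly at points of the graph.\<close>
  have range_J: "y \<in> range J \<longleftrightarrow> Q y = 0" for y
    using split[of y] QJ lin by (metis add.right_neutral linear_0 rangeE rangeI)
  have h_range: "h y \<in> range J \<longleftrightarrow> Q y = F (P y)" for y
    unfolding range_J h_def using lin by (simp add: linear_diff QK)
  have "h ` (?L \<inter> V) = range J \<inter> V"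
  proof (intro equalityI subsetI)
    fix y assume y: "y \<in> range J \<inter> V"
    then have "g y \<in> ?L \<inter> V"
      using h_range[of "g y"] gV[of y] by (simp add: hg V_def)
    then show "y \<in> h ` (?L \<inter> V)"
      by (rule image_eqI[where x = "g y", rotated]) (rule hg[symmetric])
  qed (use h_range hV in auto)
  moreover have "subspace (range J)"
    using linear_subspace_image[OF lin(3) subspace_UNIV] .
  moreover have "dim (range J) = DIM('b)"
    using dim_image_eq[OF lin(3), of UNIV] inj_on_inverseI[of _ P J] PJ by simp
  moreover have "x \<in> V"
    using \<open>x \<in> ?L\<close> by (simp add: V_def)
  ultimately have "open V \<and> x \<in> V \<and> open V \<and> diffeomorphism V V h g \<and>
      subspace (range J) \<and> dim (range J) = DIM('b) \<and> h ` (?L \<inter> V) = range J \<inter> V"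
    using \<open>open V\<close> \<open>diffeomorphism V V h g\<close> by (intro conjI)
  then show "\<exists>V (W::'a set) h g T. open V \<and> x \<in> V \<and> open W \<and> diffeomorphism V W h g \<and>
      subspace T \<and> dim T = DIM('b) \<and> h ` (?L \<inter> V) = T \<inter> W"
    by (intro exI)
qed

text \<open>Along a curve in the graph, \<open>Q (\<gamma> t) = F (P (\<gamma> t))\<close> near 0.
  Differentiating both sides at 0 gives the claim.\<close>

lemma tangent_space_graph:
  assumes "linear P" "linear Q"
    and "v \<in> tangent_space {x. P x \<in> U \<and> Q x = F (P x)} x"
    and F': "(F has_derivative F') (at (P x))"
  shows "Q v = F' (P v)"
proof -
  obtain \<gamma> e where e: "0 < (e::real)"
    and \<gamma>: "\<And>t. t \<in> {-e<..<e} \<Longrightarrow> Q (\<gamma> t) = F (P (\<gamma> t))"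
    and "\<gamma> 0 = x" and v: "(\<gamma> has_vector_derivative v) (at 0)"
    using assms(3) unfolding tangent_space_def by blast
  have Q: "((\<lambda>t. Q (\<gamma> t)) has_vector_derivative Q v) (at 0)"
    and P: "((\<lambda>t. P (\<gamma> t)) has_vector_derivative P v) (at 0)"
    using assms(1,2) v by (auto intro: bounded_linear.has_vector_derivative simp: linear_conv_bounded_linear)
  have "((\<lambda>t. F (P (\<gamma> t))) has_derivative (\<lambda>t. F' (t *\<^sub>R P v))) (at 0)"
    using has_derivative_compose[OF P[unfolded has_vector_derivative_def]] F' \<open>\<gamma> 0 = x\<close> by simp
  moreover have "F' (t *\<^sub>R P v) = t *\<^sub>R F' (P v)" for t
    using F' has_derivative_linear linear_scale by blast
  ultimately have "((\<lambda>t. F (P (\<gamma> t))) has_vector_derivative F' (P v)) (at 0)"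
    by (simp add: has_vector_derivative_def)
  then have "((\<lambda>t. Q (\<gamma> t)) has_vector_derivative F' (P v)) (at 0)"
    by (rule has_vector_derivative_transform_within_open[of _ _ _ "{-e<..<e}"]) (use e \<gamma> in auto)
  with Q show ?thesis
    by (rule vector_derivative_unique_at)
qed

text \<open>Laplace expansion, obtained by splitting off one index at a time from the permutations
  of \<open>{1, 2, 3, 4}\<close>.\<close>

lemma det_4:
  "det (A::'a::comm_ring_1^4^4) =
    A$1$1 * (A$2$2 * (A$3$3 * A$4$4 - A$3$4 * A$4$3) - A$2$3 * (A$3$2 * A$4$4 - A$3$4 * A$4$2)
      + A$2$4 * (A$3$2 * A$4$3 - A$3$3 * A$4$2)) -
    A$1$2 * (A$2$1 * (A$3$3 * A$4$4 - A$3$4 * A$4$3) - A$2$3 * (A$3$1 * A$4$4 - A$3$4 * A$4$1)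
      + A$2$4 * (A$3$1 * A$4$3 - A$3$3 * A$4$1)) +
    A$1$3 * (A$2$1 * (A$3$2 * A$4$4 - A$3$4 * A$4$2) - A$2$2 * (A$3$1 * A$4$4 - A$3$4 * A$4$1)
      + A$2$4 * (A$3$1 * A$4$2 - A$3$2 * A$4$1)) -
    A$1$4 * (A$2$1 * (A$3$2 * A$4$3 - A$3$3 * A$4$2) - A$2$2 * (A$3$1 * A$4$3 - A$3$3 * A$4$1)
      + A$2$3 * (A$3$1 * A$4$2 - A$3$2 * A$4$1))"
proof -
  have f1: "finite {2::4, 3, 4}" "1 \<notin> {2::4, 3, 4}"
    and f2: "finite {3::4, 4}" "2 \<notin> {3::4, 4}"
    and f3: "finite {4::4}" "3 \<notin> {4::4}"
    by auto
  show ?thesis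
    unfolding det_def UNIV_4
    unfolding sum_over_permutations_insert[OF f1]
    unfolding sum_over_permutations_insert[OF f2]
    unfolding sum_over_permutations_insert[OF f3]
    unfolding permutes_sing
    by (simp add: sign_swap_id permutation_swap_id permutation_compose sign_compose sign_id swap_id_eq)
      (simp only: algebra_simps)
qed

section \<open>Complex partial derivatives and their symmetry\<close>

lemma holomorphic_several_cong:
  assumes "open U" "\<And>z. z \<in> U \<Longrightarrow> f z = g z" "holomorphic_several f U"
  shows "holomorphic_several g U"
  using assms has_derivative_transform_within_open unfolding holomorphic_several_def by metis

text \<open>Varying the \<open>j\<close>-th coordinate moves along the complex line through
  \<open>z - z $ j *s axis j 1\<close> in direction \<open>axis j 1\<close>, which passes through
  \<open>z\<close> at \<open>w = z $ j\<close>.\<close>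

lemma cpartial_eq_frechet_derivative:
  assumes "holomorphic_several f U" "z \<in> U"
  shows "cpartial j f z = frechet_derivative f (at z) (axis j 1)"
proof -
  have eq: "(\<chi> i. if i = j then w else z $ i) = (z - z $ j *s axis j 1) + w *s axis j 1" for w
    by (simp add: vec_eq_iff axis_def)
  have "((\<lambda>w. f ((z - z $ j *s axis j 1) + w *s axis j 1)) has_field_derivative
      frechet_derivative f (at z) (axis j 1)) (at (z $ j))"
    using holomorphic_several_on_line[OF assms(1), of "z - z $ j *s axis j 1" "z $ j" "axis j 1"] assms(2)
    by (simp only: diff_add_cancel)
  then show ?thesis
    unfolding cpartial_def eq by (rule DERIV_imp_deriv)
qed

lemma holomorphic_several_cpartial:
  assumes "open U" "holomorphic_several f U"
  shows "holomorphic_several (cpartial j f) U"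
  using holomorphic_several_cong[OF \<open>open U\<close> _ holomorphic_several_directional_derivative[OF assms]]
    cpartial_eq_frechet_derivative[OF assms(2)] by metis

lemma frechet_derivative_cpartial:
  fixes f :: "complex^2 \<Rightarrow> complex"
  assumes "holomorphic_several f U" "z \<in> U"
  shows "frechet_derivative f (at z) v = cpartial 1 f z * v $ 1 + cpartial 2 f z * v $ 2"
proof -
  have "linear (frechet_derivative f (at z))"
    using holomorphic_several_has_derivative[OF assms] has_derivative_linear by blast
  then have "frechet_derivative f (at z) (v $ 1 *s axis 1 1 + v $ 2 *s axis 2 1) =
      cpartial 1 f z * v $ 1 + cpartial 2 f z * v $ 2"
    by (simp only: linear_add holomorphic_several_scale[OF assms]
        cpartial_eq_frechet_derivative[OF assms] mult.commute)
  moreover have "v $ 1 *s axis 1 1 + v $ 2 *s axis 2 1 = v"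
    by (simp add: vec_eq_iff forall_2 axis_def)
  ultimately show ?thesis
    by (simp only:)
qed

lemma cpartial_commute:
  assumes "open U" "holomorphic_several f U" "z \<in> U"
  shows "cpartial i (cpartial j f) z = cpartial j (cpartial i f) z"
proof -
  have "cpartial i (cpartial j f) z =
      frechet_derivative (\<lambda>z. frechet_derivative f (at z) (axis j 1)) (at z) (axis i 1)" for i j
  proof -
    \<comment> \<open>The two functions are known to agree only on \<open>U\<close>; as
      \<open>U\<close> is open, this determines the derivative at \<open>z\<close>.\<close>
    have "frechet_derivative (cpartial j f) (at z) =
        frechet_derivative (\<lambda>z. frechet_derivative f (at z) (axis j 1)) (at z)"
      by (rule frechet_derivative_transform_within_open[OF _ \<open>open U\<close> \<open>z \<in> U\<close>])
        (use holomorphic_several_has_derivative[OF holomorphic_several_cpartial[OF assms(1,2)] \<open>z \<in> U\<close>]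
          cpartial_eq_frechet_derivative[OF assms(2)] in \<open>auto intro: differentiableI\<close>)
    then show ?thesis
      using cpartial_eq_frechet_derivative[OF holomorphic_several_cpartial[OF assms(1,2)] \<open>z \<in> U\<close>]
      by simp
  qed
  then show ?thesis
    using symmetric_second_derivative[OF assms] by metis
qed

section \<open>The graph of a complex gradient\<close>

definition gradient :: "(complex^2 \<Rightarrow> complex) \<Rightarrow> complex^2 \<Rightarrow> complex^2" where
  "gradient f z = vector [cpartial 1 f z, cpartial 2 f z]"

text \<open>Mixed partials are kept as they arise from differentiating each component; their
  symmetry enters only with the symplectic form.\<close>

definition hessian_map :: "(complex^2 \<Rightarrow> complex) \<Rightarrow> complex^2 \<Rightarrow> complex^2 \<Rightarrow> complex^2" where
  "hessian_map f z v = vector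
    [cpartial 1 (cpartial 1 f) z * v $ 1 + cpartial 2 (cpartial 1 f) z * v $ 2,
     cpartial 1 (cpartial 2 f) z * v $ 1 + cpartial 2 (cpartial 2 f) z * v $ 2]"

text \<open>A sum of linear images of the entries, so the sum and linear-map rules for derivatives
  and \<open>Ck_on\<close> apply to \<open>gradient\<close>.\<close>

lemma vector_2_eq_axis: "vector [a, b] = a *s axis 1 1 + b *s (axis 2 1 :: complex^2)"
  by (simp add: vec_eq_iff forall_2 axis_def)

lemma gradient_has_derivative:
  assumes "open U" "holomorphic_several f U" "z \<in> U"
  shows "(gradient f has_derivative hessian_map f z) (at z)"
proof -
  have "(cpartial j f has_derivative
      (\<lambda>v. cpartial 1 (cpartial j f) z * v $ 1 + cpartial 2 (cpartial j f) z * v $ 2)) (at z)" for j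
    using has_derivative_eq_rhs[OF
        holomorphic_several_has_derivative[OF holomorphic_several_cpartial[OF assms(1,2)] assms(3)]
        ext[OF frechet_derivative_cpartial[OF holomorphic_several_cpartial[OF assms(1,2)] assms(3)]]] .
  then show ?thesis
    unfolding gradient_def[abs_def] hessian_map_def[abs_def] vector_2_eq_axis
    by (intro has_derivative_add
        bounded_linear.has_derivative[OF bounded_linear_vector_scalar_mult_left])
qed

lemma smooth_on_gradient:
  assumes "open U" "holomorphic_several f U"
  shows "smooth_on U (gradient f)"
proof -
  have "Ck_on n U (cpartial j f)" for n j
    using holomorphic_several_smooth_on[OF \<open>open U\<close> holomorphic_several_cpartial[OF assms]]
    by (simp add: smooth_on_def)
  then show ?thesis
    unfolding smooth_on_def gradient_def[abs_def] vector_2_eq_axis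
    by (intro allI Ck_on_add[OF \<open>open U\<close>]
        Ck_on_bounded_linear_compose[OF \<open>open U\<close> bounded_linear_vector_scalar_mult_left])
qed

text \<open>The two halves of \<open>G\<close>, and the inverse of \<open>G\<close> on either summand.\<close>

definition base :: "cotangent4 \<Rightarrow> complex^2" where
  "base x = vector [G x $ 1, G x $ 2]"

definition fibre :: "cotangent4 \<Rightarrow> complex^2" where
  "fibre x = vector [G x $ 3, G x $ 4]"

definition lift_base :: "complex^2 \<Rightarrow> cotangent4" where
  "lift_base z = (vector [0, 0, Re (z $ 2), Im (z $ 2)], vector [Re (z $ 1), - Im (z $ 1), 0, 0])"

definition lift_fibre :: "complex^2 \<Rightarrow> cotangent4" where
  "lift_fibre w = (vector [- Re (w $ 1), - Im (w $ 1), 0, 0], vector [0, 0, Re (w $ 2), - Im (w $ 2)])"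

lemmas splitting_defs = base_def fibre_def lift_base_def lift_fibre_def G_def

text \<open>Brings the preimage into the form treated by \<open>submanifold_graph\<close> and
  \<open>tangent_space_graph\<close>.\<close>

lemma vimage_L_graph: "G -` L_graph f U = {x. base x \<in> U \<and> fibre x = gradient f (base x)}"
proof -
  have "G x = vector [z $ 1, z $ 2, cpartial 1 f z, cpartial 2 f z] \<longleftrightarrow>
      base x = z \<and> fibre x = gradient f z" for x z
    by (auto simp: base_def fibre_def gradient_def vec_eq_iff forall_2 forall_4)
  then show ?thesis
    by (auto simp: L_graph_def)
qed

lemma linear_splitting: "linear base" "linear fibre" "linear lift_base" "linear lift_fibre"
  by (auto intro!: linearI
      simp: splitting_defs vec_eq_iff forall_2 forall_4 complex_eq_iff split: prod.splits)

lemma submanifold_vimage_L_graph: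
  assumes "open U" "holomorphic_several f U"
  shows "submanifold 4 (G -` L_graph f U)"
proof -
  \<comment> \<open>The real dimension of the base, which is 4.\<close>
  have "submanifold DIM(complex^2) (G -` L_graph f U)"
    unfolding vimage_L_graph
    by (rule submanifold_graph[OF linear_splitting _ _ _ _ _ \<open>open U\<close> smooth_on_gradient[OF assms]])
      (auto simp: splitting_defs vec_eq_iff forall_2 forall_4 complex_eq_iff split: prod.splits)
  then show ?thesis
    by simp
qed

lemma tangent_space_vimage_L_graph:
  assumes "open U" "holomorphic_several f U" "x \<in> G -` L_graph f U"
    and "v \<in> tangent_space (G -` L_graph f U) x"
  shows "fibre v = hessian_map f (base x) (base v)"
  using tangent_space_graph[OF linear_splitting(1,2) assms(4)[unfolded vimage_L_graph]]
    gradient_has_derivative[OF assms(1,2)] assms(3) unfolding vimage_L_graph by blast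

text \<open>The signs in \<open>G\<close> give Re (dz1 \<and> dw1) = dq1 \<and> dp1 + dq2 \<and> dp2
  and Re (dz2 \<and> dw2) = dq3 \<and> dp3 + dq4 \<and> dp4.\<close>

lemma symplectic_form_eq_Re:
  "symplectic_form v = Re (base (v 1) $ 1 * fibre (v 2) $ 1 - base (v 2) $ 1 * fibre (v 1) $ 1
     + base (v 1) $ 2 * fibre (v 2) $ 2 - base (v 2) $ 2 * fibre (v 1) $ 2)"
  by (cases "v 1"; cases "v 2")
    (simp add: symplectic_form_def wedge_def det_2 sum_4 dq_def dp_def base_def fibre_def G_def)

text \<open>Each matrix of differentials factors through the matrix of the real coordinates of \<open>z\<close>, and the
  left factor is block triangular.\<close>

lemma wedge_dp_dq_complex_graph:
  fixes v :: "4 \<Rightarrow> cotangent4"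
  assumes "\<And>j. fibre (v j) = vector [A * base (v j) $ 1 + B * base (v j) $ 2,
    C * base (v j) $ 1 + D * base (v j) $ 2]"
  defines "X \<equiv> det (\<chi> i j. (vector [Re (base (v j) $ 1), Im (base (v j) $ 1),
    Re (base (v j) $ 2), Im (base (v j) $ 2)] :: real^4) $ i)"
  shows "wedge dp v = (cmod D)\<^sup>2 * X" "wedge dq v = (cmod A)\<^sup>2 * X"
proof -
  let ?X = "(\<chi> i j. (vector [Re (base (v j) $ 1), Im (base (v j) $ 1),
    Re (base (v j) $ 2), Im (base (v j) $ 2)] :: real^4) $ i) :: real^4^4"
  \<comment> \<open>The rows are Re z1, -Im z1, Re w2, -Im w2 in the real coordinates of
    \<open>z\<close>, where w2 = C z1 + D z2. The diagonal blocks have determinants -1 and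
    \<open>- (cmod D)\<^sup>2\<close>.\<close>
  let ?P = "vector [vector [1, 0, 0, 0], vector [0, -1, 0, 0],
    vector [Re C, - Im C, Re D, - Im D], vector [- Im C, - Re C, - Im D, - Re D]] :: real^4^4"
  \<comment> \<open>The rows are -Re w1, -Im w1, Re z2, Im z2, where w1 = A z1 + B z2. The diagonal
    blocks have determinants \<open>(cmod A)\<^sup>2\<close> and 1.\<close>
  let ?Q = "vector [vector [- Re A, Im A, - Re B, Im B], vector [- Im A, - Re A, - Im B, - Re B],
    vector [0, 0, 1, 0], vector [0, 0, 0, 1]] :: real^4^4"
  have v: "v j = lift_base (base (v j)) + lift_fibre (fibre (v j))" for j
    by (simp add: splitting_defs prod_eq_iff vec_eq_iff forall_4 split: prod.splits)
  have "(\<chi> i j. dp i (v j)) = ?P ** ?X"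
    by (subst v) (simp add: assms(1) dp_def matrix_matrix_mult_def vec_eq_iff forall_4 sum_4
        lift_base_def lift_fibre_def algebra_simps)
  moreover have "det ?P = (cmod D)\<^sup>2"
    unfolding cmod_power2 by (simp add: det_4 power2_eq_square)
  ultimately show "wedge dp v = (cmod D)\<^sup>2 * X"
    by (simp add: wedge_def det_mul X_def)
  have "(\<chi> i j. dq i (v j)) = ?Q ** ?X"
    by (subst v) (simp add: assms(1) dq_def matrix_matrix_mult_def vec_eq_iff forall_4 sum_4
        lift_base_def lift_fibre_def algebra_simps)
  moreover have "det ?Q = (cmod A)\<^sup>2"
    unfolding cmod_power2 by (simp add: det_4 power2_eq_square)
  ultimately show "wedge dq v = (cmod A)\<^sup>2 * X"
    by (simp add: wedge_def det_mul X_def)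
qed

theorem proposition2:
  fixes \<phi> :: "complex^2 \<Rightarrow> complex" and U :: "(complex^2) set"
  assumes "open U"
    and "holomorphic_several \<phi> U"
    and "\<And>z. z \<in> U \<Longrightarrow>
      (cmod (cpartial 1 (cpartial 1 \<phi>) z))\<^sup>2 - (cmod (cpartial 2 (cpartial 2 \<phi>) z))\<^sup>2 = 0"
  shows "generalized_solution_hess_eq_1 (G -` L_graph \<phi> U)"
proof -
  let ?L = "G -` L_graph \<phi> U"
  have "symplectic_form v = 0" if "x \<in> ?L" "\<And>i. v i \<in> tangent_space ?L x" for x v
  proof -
    have "base x \<in> U"
      using that(1) by (simp add: vimage_L_graph)
    \<comment> \<open>With a symmetric Hessian the complex bilinear form is symmetric, so its
      antisymmetrisation in \<open>v 1\<close>, \<open>v 2\<close> is zero.\<close>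
    then have "cpartial 2 (cpartial 1 \<phi>) (base x) = cpartial 1 (cpartial 2 \<phi>) (base x)"
      by (rule cpartial_commute[OF assms(1,2)])
    then show ?thesis
      unfolding symplectic_form_eq_Re tangent_space_vimage_L_graph[OF assms(1,2) that]
      by (simp add: hessian_map_def algebra_simps)
  qed
  moreover have "omega_Hplus v = 0" if "x \<in> ?L" "\<And>i. v i \<in> tangent_space ?L x" for x v
  proof -
    have "base x \<in> U"
      using that(1) by (simp add: vimage_L_graph)
    \<comment> \<open>Both wedges are multiples of the same determinant, and the equation for
      \<open>\<phi>\<close> makes the factors equal.\<close>
    with assms(3) show ?thesis
      unfolding omega_Hplus_def
        wedge_dp_dq_complex_graph[OF tangent_space_vimage_L_graph[OF assms(1,2) that, unfolded hessian_map_def]]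
      by simp
  qed
  ultimately show ?thesis
    unfolding generalized_solution_hess_eq_1_def lagrangian_submanifold_def vanishes_on_def
    using submanifold_vimage_L_graph[OF assms(1,2)] by blast
qed

end
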